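(* The ai-semiring $SR_6$ is nonfinitely based, but it is not strongly nonfinitely based.
   Context: An additively idempotent semiring (ai-semiring) is an algebra $(S,+,\cdot)$ such that $(S,+)$ is a commutative idempotent semigroup, $(S,\cdot)$ is a semigroup, and $x(y+z)\approx xy+xz$, $(x+y)z\approx xz+yz$ hold. A variety of ai-semirings is a class of ai-semirings closed under subalgebras, homomorphic images and arbitrary direct products (equivalently, a class of ai-semirings defined by identities in the signature $\{+,\cdot\}$); $\mathsf{V}(A)$ denotes the variety generated by $A$. A variety is finitely based if it is defined by some finite set of identities, and nonfinitely based otherwise; an ai-semiring $A$ is (non)finitely based if $\mathsf{V}(A)$ is. A variety is finitely generated if it equals $\mathsf{V}(A)$ for some finite ai-semiring $A$. A finite ai-semiring is strongly nonfinitely based (SNFB) if every finitely generated variety of ai-semirings containing it is nonfinitely based (that is, it belongs to no finitely based finitely generated variety). $SR_6$ is the ai-semiring on $\{1,2,3,4,5,6\}$ with the following operations. Addition is commutative and idempotent, with $2+5=2$, $4+6=4$, and every other sum of two distinct elements equal to $1$. Multiplication is commutative, with $2\cdot 6=4\cdot 5=5\cdot 6=3$ and every other product equal to $1$. *)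

theory Defs
  imports "HOL-Library.Infinite_Typeclass"
begin

record 'a aisr =
  carrier :: "'a set"
  add :: "'a \<Rightarrow> 'a \<Rightarrow> 'a"
  mul :: "'a \<Rightarrow> 'a \<Rightarrow> 'a"

definition ai_semiring :: "'a aisr \<Rightarrow> bool" where
  "ai_semiring S \<longleftrightarrow>
     carrier S \<noteq> {} \<and>
     (\<forall>x\<in>carrier S. \<forall>y\<in>carrier S. add S x y \<in> carrier S \<and> mul S x y \<in> carrier S) \<and>
     (\<forall>x\<in>carrier S. \<forall>y\<in>carrier S. \<forall>z\<in>carrier S.
        add S (add S x y) z = add S x (add S y z)) \<and>
     (\<forall>x\<in>carrier S. \<forall>y\<in>carrier S. add S x y = add S y x) \<and>
     (\<forall>x\<in>carrier S. add S x x = x) \<and>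
     (\<forall>x\<in>carrier S. \<forall>y\<in>carrier S. \<forall>z\<in>carrier S.
        mul S (mul S x y) z = mul S x (mul S y z)) \<and>
     (\<forall>x\<in>carrier S. \<forall>y\<in>carrier S. \<forall>z\<in>carrier S.
        mul S x (add S y z) = add S (mul S x y) (mul S x z)) \<and>
     (\<forall>x\<in>carrier S. \<forall>y\<in>carrier S. \<forall>z\<in>carrier S.
        mul S (add S x y) z = add S (mul S x z) (mul S y z))"

datatype sr_term = Var nat | Plus sr_term sr_term | Times sr_term sr_term

type_synonym identity = "sr_term \<times> sr_term"

primrec eval_term :: "'a aisr \<Rightarrow> (nat \<Rightarrow> 'a) \<Rightarrow> sr_term \<Rightarrow> 'a" where
  "eval_term S \<rho> (Var i) = \<rho> i"
| "eval_term S \<rho> (Plus s t) = add S (eval_term S \<rho> s) (eval_term S \<rho> t)"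
| "eval_term S \<rho> (Times s t) = mul S (eval_term S \<rho> s) (eval_term S \<rho> t)"

definition satisfies :: "'a aisr \<Rightarrow> identity \<Rightarrow> bool" where
  "satisfies S e \<longleftrightarrow>
     (\<forall>\<rho>. range \<rho> \<subseteq> carrier S \<longrightarrow> eval_term S \<rho> (fst e) = eval_term S \<rho> (snd e))"

text \<open>
  A variety is the class of all ai-semirings satisfying some set of identities. Such a class
  ranges over all carriers, so in HOL it is represented by its members whose carrier is a subset
  of a given type; the same \<open>\<Sigma>\<close> yields a set \<open>equational_class \<Sigma>\<close> for every type.
\<close>

definition equational_class :: "identity set \<Rightarrow> 'u aisr set" where
  "equational_class \<Sigma> = {S. ai_semiring S \<and> (\<forall>e\<in>\<Sigma>. satisfies S e)}"

text \<open>
  The least variety containing \<open>A\<close>. Its members may live on a different type than \<open>A\<close>.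
\<close>

definition variety_gen :: "'a aisr \<Rightarrow> 'u aisr set" where
  "variety_gen A = (\<Inter>\<Sigma>\<in>{\<Sigma>. A \<in> equational_class \<Sigma>}. equational_class \<Sigma>)"

text \<open>
  The type argument is the universe from which the carriers of ai-semirings are drawn. Any
  infinite type will do: a variety is determined by its countable members, and every countable
  algebra (in particular every finite one) has an isomorphic copy on a subset of an infinite type.
\<close>

definition finitely_based :: "'u::infinite itself \<Rightarrow> 'a aisr \<Rightarrow> bool" where
  "finitely_based U A \<longleftrightarrow>
     (\<exists>\<Sigma>. finite \<Sigma> \<and> (variety_gen A :: 'u aisr set) = equational_class \<Sigma>)"

text \<open>
  Meant for finite ai-semirings \<open>A\<close>. The finitely generated varieties are the varieties generated
  by a finite ai-semiring \<open>B\<close>.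
\<close>

definition strongly_nonfinitely_based :: "'u::infinite itself \<Rightarrow> 'a aisr \<Rightarrow> bool" where
  "strongly_nonfinitely_based U A \<longleftrightarrow>
     (\<forall>B :: 'u aisr. ai_semiring B \<and> finite (carrier B) \<and> A \<in> variety_gen B
        \<longrightarrow> \<not> finitely_based U B)"

definition SR6 :: "nat aisr" where
  "SR6 = \<lparr>carrier = {1, 2, 3, 4, 5, 6},
     add = (\<lambda>x y. if x = y then x
                  else if {x, y} = {2, 5} then 2
                  else if {x, y} = {4, 6} then 4
                  else 1),
     mul = (\<lambda>x y. if {x, y} \<in> {{2, 6}, {4, 5}, {5, 6}} then 3 else 1)\<rparr>"

lemma ai_semiring_SR6: "ai_semiring SR6"
  by (simp add: ai_semiring_def SR6_def doubleton_eq_iff)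

lemma finite_SR6: "finite (carrier SR6)"
  by (simp add: SR6_def)

end

theory Submission
  imports Defs
begin

text \<open>
  In \<open>SR6\<close> every product of three elements is the greatest element \<open>1\<close>. Hence an identity is only
  about terms that are sums of variables and of products of two variables, and the latter can be
  read as the edges of a graph on the variables. Such a sum takes the value \<open>3\<close> exactly if its
  isolated variables are \<open>3\<close> and the others are mapped to the path \<open>2 - 6 - 5 - 4\<close> so that
  edges go to edges. A term whose graph is not bipartite therefore always has the value \<open>1\<close>: the
  odd cycles yield infinitely many identities, and the claim is that no finite set of
  identities of \<open>SR6\<close> implies all of them.

  Both halves use the same construction, \<open>graph_semiring\<close>. Its elements are the nonempty sets of
  vertices of a directed graph, with union as addition, and two further elements: the product of two
  sets is \<open>Edge\<close> if every pair of their elements is an edge, and the greatest element \<open>Top\<close>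
  otherwise.

  \<^emph>\<open>\<open>SR6\<close> is nonfinitely based.\<close> The semiring of the odd cycle of length \<open>2 * k + 3\<close> violates the
  identity of that cycle, but it satisfies every identity of \<open>SR6\<close> in at most \<open>k\<close> variables on each
  side (\<open>odd_cycle_semiring_satisfies\<close>). Indeed, a factor of a product with value \<open>Edge\<close> is a set of
  at most two vertices, having a common neighbour. So the sets that matter leave some vertex \<open>p\<close>
  of the cycle uncovered, and the cycle without \<open>p\<close> is bipartite; a \<open>2\<close>-colouring turns the
  valuation into one in \<open>SR6\<close>, by the colours \<open>5\<close> and \<open>6\<close>. For a nonadjacent pair of differently
  coloured vertices one may raise these two to \<open>2\<close> and \<open>4\<close>; as \<open>2 \<cdot> 4 = 1\<close>, this detects every
  product that is not \<open>Edge\<close>.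

  \<^emph>\<open>\<open>SR6\<close> is not strongly nonfinitely based.\<close> The identities of odd cycles come from
  the poverty of the path as a target of graph homomorphisms. A graph imposes no such identities if
  every graph can be mapped to it, with sets of vertices as images, such that edges are preserved and
  a prescribed non-edge remains a non-edge. The graph on \<open>0, 1, 2\<close> lacking only the edge from \<open>1\<close> to \<open>2\<close> is of this kind. The identities of
  its semiring follow from three identities (\<open>collapse_basis_complete\<close>), all of which hold in
  \<open>SR6\<close>.
\<close>

section \<open>Terms as joins of words\<close>

text \<open>
  The order of the join semilattice \<open>(S, +)\<close>. By distributivity the value of a term is the least
  upper bound of the values of its words. Characterizing it by its upper bounds avoids sums over
  finite sets, for which a zero would be needed.
\<close>

definition below :: "'a aisr \<Rightarrow> 'a \<Rightarrow> 'a \<Rightarrow> bool" where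
  "below S x y \<longleftrightarrow> add S x y = y"

primrec words :: "sr_term \<Rightarrow> nat list set" where
  "words (Var i) = {[i]}"
| "words (Plus s t) = words s \<union> words t"
| "words (Times s t) = {u @ v |u v. u \<in> words s \<and> v \<in> words t}"

fun word_value :: "'a aisr \<Rightarrow> (nat \<Rightarrow> 'a) \<Rightarrow> nat list \<Rightarrow> 'a" where
  "word_value S \<rho> [] = undefined"
| "word_value S \<rho> [i] = \<rho> i"
| "word_value S \<rho> (i # j # w) = mul S (\<rho> i) (word_value S \<rho> (j # w))"

definition vars :: "sr_term \<Rightarrow> nat set" where
  "vars t = (\<Union>w\<in>words t. set w)"

lemma words_not_Nil: "w \<in> words t \<Longrightarrow> w \<noteq> []"
  by (induction t arbitrary: w) auto

lemma finite_vars: "finite (vars t)"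
proof -
  have "finite (words t)"
    by (induction t) (auto simp: finite_image_set2)
  then show ?thesis
    by (simp add: vars_def)
qed

lemma word_shape:
  assumes "w \<in> words t"
  obtains (one) i where "w = [i]" | (two) i j where "w = [i, j]"
  | (long) i j k v where "w = i # j # k # v"
  using words_not_Nil[OF assms] by (metis list.exhaust)

context
  fixes S :: "'a aisr"
  assumes S: "ai_semiring S"
begin

lemma add_closed: "x \<in> carrier S \<Longrightarrow> y \<in> carrier S \<Longrightarrow> add S x y \<in> carrier S"
  and mul_closed: "x \<in> carrier S \<Longrightarrow> y \<in> carrier S \<Longrightarrow> mul S x y \<in> carrier S"
  and add_comm: "x \<in> carrier S \<Longrightarrow> y \<in> carrier S \<Longrightarrow> add S x y = add S y x"
  and add_idem: "x \<in> carrier S \<Longrightarrow> add S x x = x"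
  using S by (auto simp: ai_semiring_def)

lemma add_assoc:
  "x \<in> carrier S \<Longrightarrow> y \<in> carrier S \<Longrightarrow> z \<in> carrier S
    \<Longrightarrow> add S (add S x y) z = add S x (add S y z)"
  using S by (auto simp: ai_semiring_def)

lemma mul_assoc:
  "x \<in> carrier S \<Longrightarrow> y \<in> carrier S \<Longrightarrow> z \<in> carrier S
    \<Longrightarrow> mul S (mul S x y) z = mul S x (mul S y z)"
  using S by (auto simp: ai_semiring_def)

lemma distribs:
  "x \<in> carrier S \<Longrightarrow> y \<in> carrier S \<Longrightarrow> z \<in> carrier S
    \<Longrightarrow> mul S x (add S y z) = add S (mul S x y) (mul S x z)"
  "x \<in> carrier S \<Longrightarrow> y \<in> carrier S \<Longrightarrow> z \<in> carrier S
    \<Longrightarrow> mul S (add S x y) z = add S (mul S x z) (mul S y z)"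
  using S by (auto simp: ai_semiring_def)

lemma below_refl: "x \<in> carrier S \<Longrightarrow> below S x x"
  by (simp add: below_def add_idem)

lemma below_antisym:
  "x \<in> carrier S \<Longrightarrow> y \<in> carrier S \<Longrightarrow> below S x y \<Longrightarrow> below S y x \<Longrightarrow> x = y"
  unfolding below_def using add_comm by metis

lemma below_trans:
  "x \<in> carrier S \<Longrightarrow> y \<in> carrier S \<Longrightarrow> z \<in> carrier S
    \<Longrightarrow> below S x y \<Longrightarrow> below S y z \<Longrightarrow> below S x z"
  unfolding below_def using add_assoc by metis

lemma add_below_iff:
  assumes "x \<in> carrier S" "y \<in> carrier S" "a \<in> carrier S"
  shows "below S (add S x y) a \<longleftrightarrow> below S x a \<and> below S y a"
  using assms unfolding below_def by (metis add_assoc add_comm add_idem add_closed)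

lemma eval_closed: "range \<rho> \<subseteq> carrier S \<Longrightarrow> eval_term S \<rho> t \<in> carrier S"
  by (induction t) (auto simp: add_closed mul_closed)

lemma word_value_closed:
  "range \<rho> \<subseteq> carrier S \<Longrightarrow> w \<noteq> [] \<Longrightarrow> word_value S \<rho> w \<in> carrier S"
  by (induction w rule: induct_list012) (auto simp: mul_closed image_subset_iff)

lemma word_value_append:
  assumes \<rho>: "range \<rho> \<subseteq> carrier S" and "u \<noteq> []" "v \<noteq> []"
  shows "word_value S \<rho> (u @ v) = mul S (word_value S \<rho> u) (word_value S \<rho> v)"
  using assms(2)
proof (induction u rule: induct_list012)
  case (2 i)
  then show ?case using \<open>v \<noteq> []\<close> by (cases v) auto
next
  case (3 i j u)
  have "\<rho> i \<in> carrier S" using \<rho> by auto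
  with 3 show ?case
    using word_value_closed[OF \<rho>] \<open>v \<noteq> []\<close> by (simp add: mul_assoc)
qed simp

text \<open>
  For a product, the bound on one factor has to pass through multiplication by the other one, which
  is an additive map; hence the induction is over all additive maps \<open>h\<close> at once.
\<close>

lemma additive_eval_below_iff:
  assumes \<rho>: "range \<rho> \<subseteq> carrier S" and a: "a \<in> carrier S"
    and "\<And>x. x \<in> carrier S \<Longrightarrow> h x \<in> carrier S"
    and "\<And>x y. x \<in> carrier S \<Longrightarrow> y \<in> carrier S \<Longrightarrow> h (add S x y) = add S (h x) (h y)"
  shows "below S (h (eval_term S \<rho> t)) a \<longleftrightarrow> (\<forall>w\<in>words t. below S (h (word_value S \<rho> w)) a)"
  using assms(3,4)
proof (induction t arbitrary: h)
  case (Var i)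
  then show ?case by simp
next
  case (Plus s t)
  then show ?case
    using eval_closed[OF \<rho>] a by (simp add: add_below_iff ball_Un)
next
  case (Times s t)
  note closed = eval_closed[OF \<rho>]
  have wclosed: "word_value S \<rho> u \<in> carrier S" if "u \<in> words r" for u r
    using word_value_closed[OF \<rho>] words_not_Nil that by blast
  have "below S (h (mul S (eval_term S \<rho> s) (eval_term S \<rho> t))) a \<longleftrightarrow>
      (\<forall>u\<in>words s. below S (h (mul S (word_value S \<rho> u) (eval_term S \<rho> t))) a)"
    by (rule Times.IH(1)[where h = "\<lambda>p. h (mul S p (eval_term S \<rho> t))"])
      (auto simp: Times.prems closed mul_closed distribs)
  also have "\<dots> \<longleftrightarrow> (\<forall>u\<in>words s. \<forall>v\<in>words t.
      below S (h (mul S (word_value S \<rho> u) (word_value S \<rho> v))) a)"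
  proof (rule ball_cong[OF refl])
    fix u assume "u \<in> words s"
    then show "below S (h (mul S (word_value S \<rho> u) (eval_term S \<rho> t))) a \<longleftrightarrow>
        (\<forall>v\<in>words t. below S (h (mul S (word_value S \<rho> u) (word_value S \<rho> v))) a)"
      by (intro Times.IH(2)[where h = "\<lambda>q. h (mul S (word_value S \<rho> u) q)"])
        (auto simp: Times.prems wclosed mul_closed distribs)
  qed
  also have "\<dots> \<longleftrightarrow> (\<forall>u\<in>words s. \<forall>v\<in>words t. below S (h (word_value S \<rho> (u @ v))) a)"
    using word_value_append[OF \<rho>] words_not_Nil by (metis (no_types, lifting))
  finally show ?case by auto
qed

lemma eval_below_iff:
  assumes "range \<rho> \<subseteq> carrier S" "a \<in> carrier S"
  shows "below S (eval_term S \<rho> t) a \<longleftrightarrow> (\<forall>w\<in>words t. below S (word_value S \<rho> w) a)"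
  using additive_eval_below_iff[OF assms, of "\<lambda>x. x"] by simp

lemma word_below_eval:
  assumes "range \<rho> \<subseteq> carrier S" "w \<in> words t"
  shows "below S (word_value S \<rho> w) (eval_term S \<rho> t)"
  using eval_below_iff[OF assms(1) eval_closed[OF assms(1)], of t] below_refl eval_closed assms
  by blast

lemma eval_mono:
  assumes "range \<rho> \<subseteq> carrier S" "words s \<subseteq> words t"
  shows "below S (eval_term S \<rho> s) (eval_term S \<rho> t)"
  using eval_below_iff[OF assms(1) eval_closed[OF assms(1)]] word_below_eval assms by blast

text \<open>
  Both separating elements used below (\<open>3\<close> in \<open>SR6\<close> and the edge element of a graph semiring) are
  minimal, so that a term takes such a value exactly when all its words do.
\<close>

lemma eval_eq_minimal_iff:
  assumes \<rho>: "range \<rho> \<subseteq> carrier S" and a: "a \<in> carrier S"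
    and minimal: "\<And>x. x \<in> carrier S \<Longrightarrow> below S x a \<Longrightarrow> x = a"
  shows "eval_term S \<rho> t = a \<longleftrightarrow> (\<forall>w\<in>words t. word_value S \<rho> w = a)"
proof -
  have "eval_term S \<rho> t = a \<longleftrightarrow> below S (eval_term S \<rho> t) a"
    using minimal eval_closed[OF \<rho>] below_refl[OF a] by blast
  moreover have "word_value S \<rho> w = a \<longleftrightarrow> below S (word_value S \<rho> w) a" if "w \<in> words t" for w
    using minimal word_value_closed[OF \<rho> words_not_Nil[OF that]] below_refl[OF a] by metis
  ultimately show ?thesis
    using eval_below_iff[OF \<rho> a] by simp
qed

end

lemma satisfies_swap: "satisfies S (s, t) \<longleftrightarrow> satisfies S (t, s)"
  by (auto simp: satisfies_def)

section \<open>Copies of an algebra on another type\<close>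

text \<open>
  The varieties range over algebras with carriers in the given infinite type, so that \<open>SR6\<close> and the
  finite semirings constructed here have to be transported to it along an injection.
\<close>

definition copy :: "('a \<Rightarrow> 'b) \<Rightarrow> 'a aisr \<Rightarrow> 'b aisr" where
  "copy f S = \<lparr>carrier = f ` carrier S,
     add = (\<lambda>x y. f (add S (inv_into (carrier S) f x) (inv_into (carrier S) f y))),
     mul = (\<lambda>x y. f (mul S (inv_into (carrier S) f x) (inv_into (carrier S) f y)))\<rparr>"

context
  fixes S :: "'a aisr" and f :: "'a \<Rightarrow> 'b"
  assumes S: "ai_semiring S" and f: "inj_on f (carrier S)"
begin

lemma copy_ai_semiring: "ai_semiring (copy f S)"
  using S unfolding ai_semiring_def copy_def by (auto simp: inv_into_f_f[OF f])

lemma copy_eval: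
  assumes "range \<rho> \<subseteq> carrier S"
  shows "eval_term (copy f S) (f \<circ> \<rho>) t = f (eval_term S \<rho> t)"
  using eval_closed[OF S assms]
  by (induction t) (auto simp: copy_def inv_into_f_f[OF f])

lemma copy_satisfies_iff: "satisfies (copy f S) e \<longleftrightarrow> satisfies S e"
proof
  assume *: "satisfies (copy f S) e"
  show "satisfies S e"
    unfolding satisfies_def
  proof (intro allI impI)
    fix \<rho> :: "nat \<Rightarrow> 'a" assume \<rho>: "range \<rho> \<subseteq> carrier S"
    then have "range (f \<circ> \<rho>) \<subseteq> carrier (copy f S)"
      by (auto simp: copy_def)
    with * have "f (eval_term S \<rho> (fst e)) = f (eval_term S \<rho> (snd e))"
      unfolding satisfies_def copy_eval[OF \<rho>, symmetric] by blast
    then show "eval_term S \<rho> (fst e) = eval_term S \<rho> (snd e)"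
      using f eval_closed[OF S \<rho>] by (simp add: inj_on_eq_iff)
  qed
next
  assume *: "satisfies S e"
  show "satisfies (copy f S) e"
    unfolding satisfies_def
  proof (intro allI impI)
    fix \<tau> :: "nat \<Rightarrow> 'b" assume "range \<tau> \<subseteq> carrier (copy f S)"
    then have \<tau>: "\<tau> i \<in> f ` carrier S" for i
      by (auto simp: copy_def)
    define \<rho> where "\<rho> = inv_into (carrier S) f \<circ> \<tau>"
    have \<rho>: "range \<rho> \<subseteq> carrier S" and "\<tau> = f \<circ> \<rho>"
      using \<tau> by (auto simp: \<rho>_def inv_into_into f_inv_into_f fun_eq_iff)
    with * show "eval_term (copy f S) \<tau> (fst e) = eval_term (copy f S) \<tau> (snd e)"
      by (simp add: copy_eval satisfies_def)
  qed
qed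

lemma copy_in_equational_class_iff: "copy f S \<in> equational_class \<Sigma> \<longleftrightarrow> S \<in> equational_class \<Sigma>"
  using S by (simp add: equational_class_def copy_ai_semiring copy_satisfies_iff)

end

lemma finite_inj_to_infinite:
  assumes "finite A"
  obtains f :: "'a \<Rightarrow> 'u::infinite" where "inj_on f A"
proof -
  obtain B :: "'u set" where "finite B" "card B = card A"
    using infinite_arbitrarily_large[OF infinite_UNIV] by metis
  then show ?thesis
    using assms that by (metis finite_same_card_bij bij_betw_imp_inj_on)
qed

section \<open>Semirings of graphs\<close>

datatype 'v graph_elem = Vertices "'v set" | Edge | Top

fun graph_add :: "'v graph_elem \<Rightarrow> 'v graph_elem \<Rightarrow> 'v graph_elem" where
  "graph_add (Vertices X) (Vertices Y) = Vertices (X \<union> Y)"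
| "graph_add Edge Edge = Edge"
| "graph_add _ _ = Top"

fun graph_mul :: "('v \<times> 'v) set \<Rightarrow> 'v graph_elem \<Rightarrow> 'v graph_elem \<Rightarrow> 'v graph_elem" where
  "graph_mul E (Vertices X) (Vertices Y) = (if X \<times> Y \<subseteq> E then Edge else Top)"
| "graph_mul E _ _ = Top"

definition graph_semiring :: "'v set \<Rightarrow> ('v \<times> 'v) set \<Rightarrow> 'v graph_elem aisr" where
  "graph_semiring V E =
     \<lparr>carrier = {Edge, Top} \<union> Vertices ` {X. X \<subseteq> V \<and> X \<noteq> {}}, add = graph_add, mul = graph_mul E\<rparr>"

lemma graph_semiring_simps [simp]:
  "Vertices X \<in> carrier (graph_semiring V E) \<longleftrightarrow> X \<subseteq> V \<and> X \<noteq> {}"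
  "Edge \<in> carrier (graph_semiring V E)"
  "Top \<in> carrier (graph_semiring V E)"
  "add (graph_semiring V E) = graph_add"
  "mul (graph_semiring V E) = graph_mul E"
  by (auto simp: graph_semiring_def)

lemma graph_mul_cases: "graph_mul E x y = Edge \<or> graph_mul E x y = Top"
  by (cases x; cases y) auto

lemma graph_mul_mul: "graph_mul E (graph_mul E x y) z = Top" "graph_mul E x (graph_mul E y z) = Top"
  using graph_mul_cases[of E x y] graph_mul_cases[of E y z] by (cases x, auto)+

lemma graph_add_Top [simp]: "graph_add Top x = Top" "graph_add x Top = Top"
  by (cases x, auto)+

lemma ai_semiring_graph: "ai_semiring (graph_semiring V E)"
proof -
  have comm: "graph_add x y = graph_add y x" for x y :: "'v graph_elem"
    by (cases x; cases y) auto
  have idem: "graph_add x x = x" for x :: "'v graph_elem"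
    by (cases x) auto
  have assoc: "graph_add (graph_add x y) z = graph_add x (graph_add y z)" for x y z :: "'v graph_elem"
    by (cases x; cases y; cases z) auto
  have distrib:
    "graph_mul E x (graph_add y z) = graph_add (graph_mul E x y) (graph_mul E x z)"
    "graph_mul E (graph_add x y) z = graph_add (graph_mul E x z) (graph_mul E y z)" for x y z
    by (cases x; cases y; cases z; force)+
  have add: "graph_add x y \<in> carrier (graph_semiring V E)"
    if "x \<in> carrier (graph_semiring V E)" "y \<in> carrier (graph_semiring V E)" for x y
    using that by (cases x; cases y) auto
  have mul: "graph_mul E x y \<in> carrier (graph_semiring V E)" for x y
    using graph_mul_cases[of E x y] by (elim disjE) simp_all
  show ?thesis
    unfolding ai_semiring_def
  proof (intro conjI ballI)
    show "carrier (graph_semiring V E) \<noteq> {}" by (simp add: graph_semiring_def)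
  qed (use comm idem assoc distrib add mul in \<open>simp_all only: graph_semiring_simps graph_mul_mul\<close>)
qed

lemma below_Edge: "below (graph_semiring V E) x Edge \<Longrightarrow> x = Edge"
  by (cases x) (auto simp: below_def)

lemma below_Top: "below (graph_semiring V E) x Top"
  by (simp add: below_def)

lemma eval_eq_Edge_iff:
  assumes "range \<rho> \<subseteq> carrier (graph_semiring V E)"
  shows "eval_term (graph_semiring V E) \<rho> t = Edge \<longleftrightarrow>
    (\<forall>w\<in>words t. word_value (graph_semiring V E) \<rho> w = Edge)"
  by (rule eval_eq_minimal_iff[OF ai_semiring_graph assms]) (use below_Edge in auto)

lemma graph_long_word: "word_value (graph_semiring V E) \<rho> (i # j # k # v) = Top"
  by (cases v) (simp_all add: graph_mul_mul)

lemma finite_graph_semiring: "finite V \<Longrightarrow> finite (carrier (graph_semiring V E))"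
  by (simp add: graph_semiring_def)

section \<open>A finitely based variety containing \<open>SR6\<close>\<close>

text \<open>
  This identity says that every value of \<open>t\<close> is the greatest element, provided that \<open>3\<close> is not a
  variable of \<open>t\<close>. Consequently all values of all terms with this property coincide, and no separate
  identities between them are required.
\<close>

abbreviation collapses :: "sr_term \<Rightarrow> identity" where
  "collapses t \<equiv> (Plus t (Var 3), t)"

definition collapse_basis :: "identity set" where
  "collapse_basis =
     {collapses (Times (Times (Var 0) (Var 1)) (Var 2)),
      collapses (Plus (Var 0) (Times (Var 0) (Var 1))),
      collapses (Plus (Var 0) (Times (Var 1) (Var 0)))}"

lemma satisfies_collapse_basisI:
  assumes "\<And>x y z w. \<lbrakk>x \<in> carrier S; y \<in> carrier S; z \<in> carrier S; w \<in> carrier S\<rbrakk>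
      \<Longrightarrow> add S (mul S (mul S x y) z) w = mul S (mul S x y) z"
    and "\<And>x y w. \<lbrakk>x \<in> carrier S; y \<in> carrier S; w \<in> carrier S\<rbrakk>
      \<Longrightarrow> add S (add S x (mul S x y)) w = add S x (mul S x y)"
    and "\<And>x y w. \<lbrakk>x \<in> carrier S; y \<in> carrier S; w \<in> carrier S\<rbrakk>
      \<Longrightarrow> add S (add S x (mul S y x)) w = add S x (mul S y x)"
  shows "\<forall>e\<in>collapse_basis. satisfies S e"
proof -
  have "\<rho> i \<in> carrier S" if "range \<rho> \<subseteq> carrier S" for \<rho> :: "nat \<Rightarrow> 'a" and i
    using that by auto
  then show ?thesis
    using assms by (auto simp: collapse_basis_def satisfies_def)
qed

lemma collapse_basisD:
  assumes S: "\<forall>e\<in>collapse_basis. satisfies S e"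
    and "x \<in> carrier S" "y \<in> carrier S" "z \<in> carrier S" "w \<in> carrier S"
  shows "add S (mul S (mul S x y) z) w = mul S (mul S x y) z"
    and "add S (add S x (mul S x y)) w = add S x (mul S x y)"
    and "add S (add S x (mul S y x)) w = add S x (mul S y x)"
proof -
  let ?\<rho> = "\<lambda>i::nat. if i = 0 then x else if i = 1 then y else if i = 2 then z else w"
  have "range ?\<rho> \<subseteq> carrier S"
    using assms(2-5) by auto
  then have eq: "eval_term S ?\<rho> t = eval_term S ?\<rho> s" if "(t, s) \<in> collapse_basis" for t s
    using bspec[OF S that] by (simp add: satisfies_def)
  show "add S (mul S (mul S x y) z) w = mul S (mul S x y) z"
    using eq[of "Plus (Times (Times (Var 0) (Var 1)) (Var 2)) (Var 3)"]
    by (simp add: collapse_basis_def)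
  show "add S (add S x (mul S x y)) w = add S x (mul S x y)"
    using eq[of "Plus (Plus (Var 0) (Times (Var 0) (Var 1))) (Var 3)"]
    by (simp add: collapse_basis_def)
  show "add S (add S x (mul S y x)) w = add S x (mul S y x)"
    using eq[of "Plus (Plus (Var 0) (Times (Var 1) (Var 0))) (Var 3)"]
    by (simp add: collapse_basis_def)
qed

lemma graph_semiring_collapse: "\<forall>e\<in>collapse_basis. satisfies (graph_semiring V E) e"
proof (rule satisfies_collapse_basisI)
  fix x y w :: "'a graph_elem"
  have "graph_add x (graph_mul E x y) = Top" "graph_add x (graph_mul E y x) = Top"
    by (cases x; cases y; auto)+
  then show "add (graph_semiring V E) (add (graph_semiring V E) x (mul (graph_semiring V E) x y)) w =
      add (graph_semiring V E) x (mul (graph_semiring V E) x y)"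
    and "add (graph_semiring V E) (add (graph_semiring V E) x (mul (graph_semiring V E) y x)) w =
      add (graph_semiring V E) x (mul (graph_semiring V E) y x)"
    by simp_all
qed (simp add: graph_mul_mul)

text \<open>
  The terms to which one of the three identities applies.
\<close>

definition collapsing :: "sr_term \<Rightarrow> bool" where
  "collapsing t \<longleftrightarrow> (\<exists>w\<in>words t. length w \<ge> 3) \<or>
     (\<exists>i j. [i] \<in> words t \<and> ([i, j] \<in> words t \<or> [j, i] \<in> words t))"

text \<open>
  The value of a collapsing term lies above a value of one of the three terms of the basis: a long
  word is a product of its first two variables and a nonempty rest, and otherwise the two words
  sharing the variable \<open>i\<close> add up to such a value.
\<close>

lemma collapsing_eval_greatest:
  assumes S: "ai_semiring S" and basis: "\<forall>e\<in>collapse_basis. satisfies S e"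
    and \<rho>: "range \<rho> \<subseteq> carrier S" and t: "collapsing t" and a: "a \<in> carrier S"
  shows "below S a (eval_term S \<rho> t)"
proof -
  note closed = eval_closed[OF S \<rho>, of t]
  have \<rho>i: "\<rho> i \<in> carrier S" for i using \<rho> by auto
  have "\<exists>b\<in>carrier S. below S b (eval_term S \<rho> t) \<and> below S a b"
    using t unfolding collapsing_def
  proof (elim disjE bexE exE conjE)
    fix w assume w: "w \<in> words t" "length w \<ge> 3"
    obtain i j k v where w_def: "w = i # j # k # v"
      by (rule word_shape[OF w(1)]) (use w(2) that in auto)
    have v: "word_value S \<rho> (k # v) \<in> carrier S"
      using word_value_closed[OF S \<rho>] by simp
    have "word_value S \<rho> w = mul S (mul S (\<rho> i) (\<rho> j)) (word_value S \<rho> (k # v))"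
      using v \<rho>i by (simp add: w_def mul_assoc[OF S])
    then have "below S a (word_value S \<rho> w)"
      using collapse_basisD(1)[OF basis \<rho>i \<rho>i v a] v
      by (simp add: below_def add_comm[OF S a] mul_closed[OF S] \<rho>i)
    then show ?thesis
      using word_below_eval[OF S \<rho> w(1)] word_value_closed[OF S \<rho> words_not_Nil[OF w(1)]] by blast
  next
    fix i j assume ij: "[i] \<in> words t" "[i, j] \<in> words t"
    let ?b = "add S (\<rho> i) (mul S (\<rho> i) (\<rho> j))"
    have b: "?b \<in> carrier S" using \<rho>i by (simp add: add_closed[OF S] mul_closed[OF S])
    have "below S ?b (eval_term S \<rho> t)"
      using word_below_eval[OF S \<rho> ij(1)] word_below_eval[OF S \<rho> ij(2)] \<rho>i closed
      by (simp add: add_below_iff[OF S] mul_closed[OF S])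
    moreover have "below S a ?b"
      using collapse_basisD(2)[OF basis \<rho>i \<rho>i a a] b by (simp add: below_def add_comm[OF S a b])
    ultimately show ?thesis using b by blast
  next
    fix i j assume ij: "[i] \<in> words t" "[j, i] \<in> words t"
    let ?b = "add S (\<rho> i) (mul S (\<rho> j) (\<rho> i))"
    have b: "?b \<in> carrier S" using \<rho>i by (simp add: add_closed[OF S] mul_closed[OF S])
    have "below S ?b (eval_term S \<rho> t)"
      using word_below_eval[OF S \<rho> ij(1)] word_below_eval[OF S \<rho> ij(2)] \<rho>i closed
      by (simp add: add_below_iff[OF S] mul_closed[OF S])
    moreover have "below S a ?b"
      using collapse_basisD(3)[OF basis \<rho>i \<rho>i a a] b by (simp add: below_def add_comm[OF S a b])
    ultimately show ?thesis using b by blast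
  qed
  then show ?thesis
    using below_trans[OF S] a closed by blast
qed

text \<open>
  The vertex \<open>0\<close>, adjacent to all vertices and itself, serves as the image of variables outside the
  pair to be separated.
\<close>

definition universal_semiring :: "nat graph_elem aisr" where
  "universal_semiring = graph_semiring {0, 1, 2} ({0, 1, 2} \<times> {0, 1, 2} - {(1, 2)})"

text \<open>
  Suppose that \<open>t\<close> lacks the word \<open>i j\<close>. Map the isolated variables of \<open>t\<close> to \<open>Edge\<close>, the
  others to \<open>{0}\<close>, and add the vertex \<open>1\<close> to the image of \<open>i\<close> and \<open>2\<close> to that of \<open>j\<close>. The only
  word of length two that is sent to \<open>Top\<close> is \<open>i j\<close>, which also covers the case \<open>i = j\<close>. Hence
  \<open>t\<close> has the value \<open>Edge\<close>, and so has \<open>s\<close>; so \<open>i j\<close> is not a word of \<open>s\<close> either.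
\<close>

lemma universal_words_subset:
  assumes id: "satisfies universal_semiring (t, s)" and t: "\<not> collapsing t"
  shows "words s \<subseteq> words t"
proof
  fix w assume w: "w \<in> words s"
  define \<rho> where "\<rho> i j l = (if [l] \<in> words t then Edge else
      Vertices ({0} \<union> (if l = i then {1} else {}) \<union> (if l = j then {2} else {}) :: nat set))" for i j l :: nat
  let ?G = "universal_semiring"
  have range: "range (\<rho> i j) \<subseteq> carrier ?G" for i j
    by (auto simp: \<rho>_def universal_semiring_def)
  have "word_value ?G (\<rho> i j) u = Edge" if "[i, j] \<notin> words t" "u \<in> words t" for i j u
    using that(2)
  proof (cases rule: word_shape)
    case (one k)
    then show ?thesis using that by (simp add: \<rho>_def)
  next
    case (two k l)
    then have "[k] \<notin> words t" "[l] \<notin> words t"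
      using t that(2) by (auto simp: collapsing_def)
    moreover have "\<not> (k = i \<and> l = j)"
      using that two by auto
    ultimately show ?thesis
      using two by (auto simp: \<rho>_def universal_semiring_def split: if_splits)
  next
    case (long k l m v)
    then show ?thesis using t that(2) by (auto simp: collapsing_def)
  qed
  then have "eval_term ?G (\<rho> i j) t = Edge" if "[i, j] \<notin> words t" for i j
    using eval_eq_Edge_iff that range unfolding universal_semiring_def by blast
  then have "eval_term ?G (\<rho> i j) s = Edge" if "[i, j] \<notin> words t" for i j
    using id range that by (simp add: satisfies_def)
  then have val: "word_value ?G (\<rho> i j) w = Edge" if "[i, j] \<notin> words t" for i j
    using eval_eq_Edge_iff w that range unfolding universal_semiring_def by blast
  \<comment> \<open>Words of other lengths are handled by marking a variable that occurs in neither \<open>t\<close> nor \<open>w\<close>.\<close>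
  obtain n where n: "n \<notin> vars t \<union> set w"
    using ex_new_if_finite[of "vars t \<union> set w"] finite_vars by auto
  then have nn: "[n, n] \<notin> words t" by (auto simp: vars_def)
  show "w \<in> words t"
    using w
  proof (cases rule: word_shape)
    case (one k)
    then show ?thesis using val[OF nn] by (auto simp: \<rho>_def split: if_splits)
  next
    case (two k l)
    show ?thesis
    proof (rule ccontr)
      assume "w \<notin> words t"
      with two val[of k l] show False
        by (auto simp: \<rho>_def universal_semiring_def split: if_splits)
    qed
  next
    case (long k l m v)
    then show ?thesis
      using val[OF nn] by (simp add: universal_semiring_def graph_long_word del: word_value.simps)
  qed
qed

lemma universal_identity_below:
  assumes id: "satisfies universal_semiring (t, s)"
    and S: "ai_semiring S" and basis: "\<forall>e\<in>collapse_basis. satisfies S e"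
    and \<rho>: "range \<rho> \<subseteq> carrier S"
  shows "below S (eval_term S \<rho> s) (eval_term S \<rho> t)"
proof (cases "collapsing t")
  case True
  then show ?thesis using collapsing_eval_greatest[OF S basis \<rho>] eval_closed[OF S \<rho>] by blast
next
  case False
  then show ?thesis using eval_mono[OF S \<rho> universal_words_subset[OF id]] by blast
qed

lemma collapse_basis_complete:
  assumes id: "satisfies universal_semiring e"
    and S: "ai_semiring S" and basis: "\<forall>e\<in>collapse_basis. satisfies S e"
  shows "satisfies S e"
proof -
  obtain t s where e: "e = (t, s)" by fastforce
  show ?thesis
    unfolding satisfies_def
  proof (intro allI impI)
    fix \<rho> :: "nat \<Rightarrow> 'a" assume \<rho>: "range \<rho> \<subseteq> carrier S"
    have "below S (eval_term S \<rho> s) (eval_term S \<rho> t)" "below S (eval_term S \<rho> t) (eval_term S \<rho> s)"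
      using universal_identity_below[OF _ S basis \<rho>] id e satisfies_swap by blast+
    then show "eval_term S \<rho> (fst e) = eval_term S \<rho> (snd e)"
      using below_antisym[OF S] eval_closed[OF S \<rho>] e by simp
  qed
qed

lemma SR6_mul_mul: "mul SR6 (mul SR6 x y) z = 1" "mul SR6 x (mul SR6 y z) = 1"
  by (auto simp: SR6_def doubleton_eq_iff)

lemma SR6_mul_1: "mul SR6 x 1 = 1"
  by (simp add: SR6_def doubleton_eq_iff)

lemma SR6_add_1: "add SR6 1 x = 1" "add SR6 x 1 = 1"
  by (auto simp: SR6_def doubleton_eq_iff)

lemma SR6_collapse: "\<forall>e\<in>collapse_basis. satisfies SR6 e"
proof (rule satisfies_collapse_basisI)
  fix x y w
  have "add SR6 x (mul SR6 x y) = 1" "add SR6 x (mul SR6 y x) = 1"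
    by (auto simp: SR6_def doubleton_eq_iff)
  then show "add SR6 (add SR6 x (mul SR6 x y)) w = add SR6 x (mul SR6 x y)"
    and "add SR6 (add SR6 x (mul SR6 y x)) w = add SR6 x (mul SR6 y x)"
    by (simp_all only: SR6_add_1)
qed (simp only: SR6_mul_mul SR6_add_1)

text \<open>
  The three identities define exactly the variety generated by the universal semiring: its members
  satisfy them, and conversely every model of them satisfies all identities of the universal
  semiring.
\<close>

lemma not_strongly_nonfinitely_based_SR6: "\<not> strongly_nonfinitely_based TYPE('u::infinite) SR6"
proof -
  have G: "ai_semiring universal_semiring" and fin: "finite (carrier universal_semiring)"
    by (simp_all add: universal_semiring_def ai_semiring_graph finite_graph_semiring
        del: graph_semiring_simps)
  obtain f :: "nat graph_elem \<Rightarrow> 'u" where f: "inj_on f (carrier universal_semiring)"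
    using finite_inj_to_infinite[OF fin] by blast
  define B where "B = copy f universal_semiring"
  have B: "ai_semiring B" "finite (carrier B)"
    using copy_ai_semiring[OF G f] fin by (simp_all add: B_def copy_def)
  have basis: "B \<in> equational_class collapse_basis"
    using G copy_in_equational_class_iff[OF G f] graph_semiring_collapse
    unfolding B_def equational_class_def universal_semiring_def by blast
  have complete: "equational_class collapse_basis \<subseteq> variety_gen B"
  proof
    fix S :: "'b aisr" assume "S \<in> equational_class collapse_basis"
    then show "S \<in> variety_gen B"
      using collapse_basis_complete[of _ S] copy_satisfies_iff[OF G f]
      unfolding variety_gen_def equational_class_def B_def by blast
  qed
  have "SR6 \<in> variety_gen B"
    using complete SR6_collapse ai_semiring_SR6 by (auto simp: equational_class_def)
  moreover have "finitely_based TYPE('u) B"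
    unfolding finitely_based_def
  proof (intro exI conjI)
    show "finite collapse_basis" by (simp add: collapse_basis_def)
    show "variety_gen B = (equational_class collapse_basis :: 'u aisr set)"
      using basis complete by (auto simp: variety_gen_def)
  qed
  ultimately show ?thesis
    using B unfolding strongly_nonfinitely_based_def by blast
qed

section \<open>Odd cycles and the variety of \<open>SR6\<close>\<close>

text \<open>
  The cycle has the vertices \<open>0, \<dots>, n\<close>, and thus \<open>n + 1\<close> edges; it is odd for even \<open>n\<close>.
\<close>

definition cycle_edges :: "nat \<Rightarrow> (nat \<times> nat) set" where
  "cycle_edges n = {(i, j). i \<le> n \<and> j \<le> n \<and>
     (j = Suc i \<or> i = Suc j \<or> (i = 0 \<and> j = n) \<or> (i = n \<and> j = 0))}"

definition odd_cycle_semiring :: "nat \<Rightarrow> nat graph_elem aisr" where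
  "odd_cycle_semiring k = graph_semiring {..2 * k + 2} (cycle_edges (2 * k + 2))"

lemma ai_semiring_odd_cycle: "ai_semiring (odd_cycle_semiring k)"
  by (simp only: odd_cycle_semiring_def ai_semiring_graph)

primrec path_term :: "nat \<Rightarrow> sr_term" where
  "path_term 0 = Times (Var 0) (Var 1)"
| "path_term (Suc n) = Plus (path_term n) (Times (Var (Suc n)) (Var (Suc (Suc n))))"

definition odd_cycle_identity :: "nat \<Rightarrow> identity" where
  "odd_cycle_identity k =
     (Plus (path_term (2 * k + 1)) (Times (Var (2 * k + 2)) (Var 0)), Times (Var 0) (Var 0))"

lemma words_path_term: "words (path_term n) = {[i, Suc i] |i. i \<le> n}"
  by (induction n) (auto simp: le_Suc_eq)

lemma SR6_eval_eq_3_iff: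
  assumes "range \<rho> \<subseteq> carrier SR6"
  shows "eval_term SR6 \<rho> t = 3 \<longleftrightarrow> (\<forall>w\<in>words t. word_value SR6 \<rho> w = 3)"
  by (rule eval_eq_minimal_iff[OF ai_semiring_SR6 assms])
    (auto simp: SR6_def below_def doubleton_eq_iff split: if_splits)

lemma SR6_long_word: "word_value SR6 \<rho> (i # j # k # v) = 1"
  by (cases v) (simp_all only: word_value.simps SR6_mul_mul SR6_mul_1)

lemma SR6_mul_values: "mul SR6 a b = 1 \<or> mul SR6 a b = 3"
  by (simp add: SR6_def)

lemma SR6_add_values: "a \<in> {1, 3} \<Longrightarrow> b \<in> {1, 3} \<Longrightarrow> add SR6 a b \<in> {1, 3}"
  by (auto simp: SR6_def doubleton_eq_iff)

text \<open>
  The elements \<open>2\<close> and \<open>5\<close> are one colour class of the path \<open>2 - 6 - 5 - 4\<close>, so an odd cycle cannot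
  be mapped to it.
\<close>

lemma SR6_mul_eq_3: "mul SR6 a b = 3 \<Longrightarrow> a \<in> {2, 5} \<longleftrightarrow> b \<notin> {2, 5}"
  by (auto simp: SR6_def doubleton_eq_iff split: if_splits)

lemma SR6_odd_cycle_identity: "satisfies SR6 (odd_cycle_identity k)"
  unfolding satisfies_def
proof (intro allI impI)
  fix \<rho> :: "nat \<Rightarrow> nat" assume \<rho>: "range \<rho> \<subseteq> carrier SR6"
  define t where "t = fst (odd_cycle_identity k)"
  have path: "eval_term SR6 \<rho> (path_term n) \<in> {1, 3}" for n
  proof (induction n)
    case 0
    then show ?case using SR6_mul_values[of "\<rho> 0" "\<rho> 1"] by auto
  next
    case (Suc n)
    then show ?case
      using SR6_add_values SR6_mul_values[of "\<rho> (Suc n)" "\<rho> (Suc (Suc n))"] by simp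
  qed
  have "eval_term SR6 \<rho> t \<in> {1, 3}"
    using SR6_add_values[OF path[of "2 * k + 1"]] SR6_mul_values[of "\<rho> (2 * k + 2)" "\<rho> 0"]
    by (simp add: t_def odd_cycle_identity_def del: path_term.simps)
  moreover have "eval_term SR6 \<rho> t \<noteq> 3"
  proof
    assume "eval_term SR6 \<rho> t = 3"
    then have val: "word_value SR6 \<rho> w = 3" if "w \<in> words t" for w
      using SR6_eval_eq_3_iff[OF \<rho>] that by blast
    have step: "mul SR6 (\<rho> i) (\<rho> (Suc i)) = 3" if "i \<le> 2 * k + 1" for i
      using val[of "[i, Suc i]"] that
      by (auto simp: t_def odd_cycle_identity_def words_path_term simp del: path_term.simps)
    have colour: "i \<le> 2 * k + 2 \<Longrightarrow> \<rho> i \<in> {2, 5} \<longleftrightarrow> (\<rho> 0 \<in> {2, 5} \<longleftrightarrow> even i)" for i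
    proof (induction i)
      case (Suc i)
      then show ?case using SR6_mul_eq_3[OF step[of i]] by auto
    qed simp
    have "mul SR6 (\<rho> (2 * k + 2)) (\<rho> 0) = 3"
      using val[of "[2 * k + 2, 0]"] by (simp add: t_def odd_cycle_identity_def)
    from SR6_mul_eq_3[OF this] colour[of "2 * k + 2"] show False by auto
  qed
  ultimately show "eval_term SR6 \<rho> (fst (odd_cycle_identity k)) =
      eval_term SR6 \<rho> (snd (odd_cycle_identity k))"
    by (auto simp: t_def odd_cycle_identity_def SR6_def doubleton_eq_iff)
qed

lemma odd_cycle_semiring_identity: "\<not> satisfies (odd_cycle_semiring k) (odd_cycle_identity k)"
proof
  assume *: "satisfies (odd_cycle_semiring k) (odd_cycle_identity k)"
  define n where "n = 2 * k + 2"
  define \<rho> :: "nat \<Rightarrow> nat graph_elem" where "\<rho> i = Vertices {if i \<le> n then i else 0}" for i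
  have \<rho>: "range \<rho> \<subseteq> carrier (graph_semiring {..n} (cycle_edges n))"
    by (auto simp: \<rho>_def)
  have "eval_term (graph_semiring {..n} (cycle_edges n)) \<rho> (fst (odd_cycle_identity k)) = Edge"
    unfolding eval_eq_Edge_iff[OF \<rho>]
    by (auto simp: odd_cycle_identity_def words_path_term \<rho>_def cycle_edges_def n_def
        simp del: path_term.simps)
  moreover have "eval_term (graph_semiring {..n} (cycle_edges n)) \<rho> (snd (odd_cycle_identity k)) = Top"
    by (simp add: odd_cycle_identity_def \<rho>_def cycle_edges_def n_def)
  ultimately show False
    using * \<rho> by (simp add: satisfies_def odd_cycle_semiring_def n_def del: graph_semiring_simps)
qed

text \<open>
  Without \<open>p\<close>, the cycle is the path \<open>p + 1, \<dots>, n, 0, \<dots>, p - 1\<close>. On it the colours alternate also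
  at the step from \<open>n\<close> to \<open>0\<close>, where \<open>n\<close> is even, because the parity is swapped above \<open>p\<close>.
\<close>

definition colour :: "nat \<Rightarrow> nat \<Rightarrow> bool" where
  "colour p i \<longleftrightarrow> (if i < p then even i else odd i)"

lemma colour_edge:
  assumes "(i, j) \<in> cycle_edges (2 * k + 2)" "i \<noteq> p" "j \<noteq> p" "p \<le> 2 * k + 2"
  shows "colour p i \<noteq> colour p j"
  using assms by (auto simp: cycle_edges_def colour_def)

lemma cycle_edges_sym: "(i, j) \<in> cycle_edges n \<Longrightarrow> (j, i) \<in> cycle_edges n"
  by (auto simp: cycle_edges_def)

text \<open>
  A monochromatic set is mapped to the join of the images of its vertices, where those
  of the two colours go to \<open>5\<close> and \<open>6\<close>, except that \<open>u\<close>, if of the first colour, goes to \<open>2\<close> and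
  \<open>v\<close>, if of the second one, to \<open>4\<close>. As sets containing \<open>p\<close>
  are sent to \<open>1\<close>, the choice \<open>u = v = p\<close> raises no vertex at all.
\<close>

fun SR6_marking :: "nat \<Rightarrow> nat \<Rightarrow> nat \<Rightarrow> nat graph_elem \<Rightarrow> nat" where
  "SR6_marking p u v Edge = 3"
| "SR6_marking p u v Top = 1"
| "SR6_marking p u v (Vertices X) =
    (if p \<in> X then 1
     else if \<forall>i\<in>X. colour p i then (if u \<in> X then 2 else 5)
     else if \<forall>i\<in>X. \<not> colour p i then (if v \<in> X then 4 else 6)
     else 1)"

lemma SR6_marking_carrier: "SR6_marking p u v e \<in> carrier SR6"
  by (cases e) (auto simp: SR6_def)

text \<open>
  The elements of \<open>X\<close> are adjacent to those of \<open>Y\<close>, so the two sets have opposite colours. The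
  product of their images would be \<open>1\<close> only if one contained \<open>u\<close> and the other one \<open>v\<close>, which are not
  adjacent.
\<close>

lemma SR6_marking_mul:
  assumes E: "X \<times> Y \<subseteq> cycle_edges (2 * k + 2)" "(u, v) \<notin> cycle_edges (2 * k + 2)"
    and XY: "X \<noteq> {}" "Y \<noteq> {}" "p \<notin> X" "p \<notin> Y" and p: "p \<le> 2 * k + 2"
  shows "mul SR6 (SR6_marking p u v (Vertices X)) (SR6_marking p u v (Vertices Y)) = 3"
proof -
  obtain x y where xy: "x \<in> X" "y \<in> Y"
    using XY by blast
  have "colour p i \<noteq> colour p j" if "i \<in> X" "j \<in> Y" for i j
    using colour_edge[of i j k p] that E(1) XY p by blast
  then have X: "\<forall>i\<in>X. colour p i \<longleftrightarrow> colour p x" and Y: "\<forall>j\<in>Y. colour p j \<longleftrightarrow> \<not> colour p x"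
    using xy by blast+
  have "\<not> (u \<in> X \<and> v \<in> Y)" "\<not> (v \<in> X \<and> u \<in> Y)"
    using E cycle_edges_sym by blast+
  with X Y XY xy show ?thesis
    by (cases "colour p x") (auto simp: SR6_def doubleton_eq_iff)
qed

lemma SR6_marking_eq_5:
  "SR6_marking p p p e = 5 \<Longrightarrow> \<exists>X. e = Vertices X \<and> p \<notin> X \<and> (\<forall>i\<in>X. colour p i)"
  by (cases e) (auto split: if_splits)

lemma SR6_marking_eq_6:
  "SR6_marking p p p e = 6 \<Longrightarrow> \<exists>X. e = Vertices X \<and> p \<notin> X \<and> (\<forall>i\<in>X. \<not> colour p i)"
  by (cases e) (auto split: if_splits)

lemma SR6_marking_unmarked: "SR6_marking p p p e \<in> {1, 3, 5, 6}"
  by (cases e) auto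

lemma SR6_mul_eq_3_unmarked:
  assumes "mul SR6 a b = 3" "a \<in> {1, 3, 5, 6}" "b \<in> {1, 3, 5, 6}"
  shows "a = 5 \<and> b = 6 \<or> a = 6 \<and> b = 5"
  using assms by (auto simp: SR6_def doubleton_eq_iff)

text \<open>
  The valuation without raised vertices shows that both factors are sets of opposite colours. If they
  contained nonadjacent vertices, raising these would produce \<open>2 \<cdot> 4 = 1\<close>.
\<close>

lemma SR6_marking_mul_converse:
  assumes mul: "\<And>u v. (u, v) \<notin> cycle_edges n \<Longrightarrow>
      mul SR6 (SR6_marking p u v a) (SR6_marking p u v b) = 3"
    and p: "(p, p) \<notin> cycle_edges n"
  shows "graph_mul (cycle_edges n) a b = Edge"
proof (rule ccontr)
  assume not_Edge: "graph_mul (cycle_edges n) a b \<noteq> Edge"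
  have "SR6_marking p p p a = 5 \<and> SR6_marking p p p b = 6 \<or>
      SR6_marking p p p a = 6 \<and> SR6_marking p p p b = 5"
    by (rule SR6_mul_eq_3_unmarked[OF mul[OF p] SR6_marking_unmarked SR6_marking_unmarked])
  then have "\<exists>X Y. a = Vertices X \<and> b = Vertices Y \<and> p \<notin> X \<and> p \<notin> Y \<and>
      ((\<forall>i\<in>X. colour p i) \<and> (\<forall>i\<in>Y. \<not> colour p i) \<or>
       (\<forall>i\<in>X. \<not> colour p i) \<and> (\<forall>i\<in>Y. colour p i))"
    by (elim disjE conjE) (force dest!: SR6_marking_eq_5 SR6_marking_eq_6)+
  then obtain X Y where ab: "a = Vertices X" "b = Vertices Y" and X: "p \<notin> X" and Y: "p \<notin> Y"
    and colours: "(\<forall>i\<in>X. colour p i) \<and> (\<forall>i\<in>Y. \<not> colour p i) \<or>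
      (\<forall>i\<in>X. \<not> colour p i) \<and> (\<forall>i\<in>Y. colour p i)"
    by (elim exE conjE) (rule that; assumption)
  have "\<not> X \<times> Y \<subseteq> cycle_edges n"
    using not_Edge ab by (simp split: if_splits)
  then obtain u v where uv: "u \<in> X" "v \<in> Y" "(u, v) \<notin> cycle_edges n"
    by blast
  then have vu: "(v, u) \<notin> cycle_edges n"
    using cycle_edges_sym by blast
  from colours show False
  proof
    assume "(\<forall>i\<in>X. colour p i) \<and> (\<forall>i\<in>Y. \<not> colour p i)"
    with mul[OF uv(3)] uv X Y show False
      by (auto simp: ab SR6_def doubleton_eq_iff split: if_splits)
  next
    assume "(\<forall>i\<in>X. \<not> colour p i) \<and> (\<forall>i\<in>Y. colour p i)"
    with mul[OF vu] uv X Y show False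
      by (auto simp: ab SR6_def doubleton_eq_iff split: if_splits)
  qed
qed

lemma cycle_common_neighbours:
  assumes "X \<times> Y \<subseteq> cycle_edges n" "Y \<noteq> {}"
  shows "finite X \<and> card X \<le> 2"
proof -
  obtain y where "y \<in> Y" using assms by blast
  then have "X \<subseteq> {if y = 0 then n else y - 1, if y = n then 0 else Suc y}"
    using assms by (fastforce simp: cycle_edges_def)
  moreover have "card {if y = 0 then n else y - 1, if y = n then 0 else Suc y} \<le> 2"
    by (simp add: card_insert_if)
  ultimately show ?thesis
    by (meson card_mono finite.emptyI finite.insertI finite_subset le_trans)
qed

text \<open>
  At most \<open>k\<close> sets with at most two elements cannot cover the \<open>2 * k + 3\<close> vertices of the cycle.
\<close>

lemma uncovered_vertex:
  assumes "card (vars t) \<le> k"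
  obtains p where "p \<le> 2 * k + 2"
    "\<And>i X. i \<in> vars t \<Longrightarrow> \<rho> i = Vertices X \<Longrightarrow> finite X \<Longrightarrow> card X \<le> 2 \<Longrightarrow> p \<notin> X"
proof -
  define U where "U i = (case \<rho> i of Vertices X \<Rightarrow> if finite X \<and> card X \<le> 2 then X else {} | _ \<Rightarrow> {})" for i
  have U: "finite (U i)" "card (U i) \<le> 2" for i
    by (auto simp: U_def split: graph_elem.split)
  have "card (\<Union>i\<in>vars t. U i) \<le> (\<Sum>i\<in>vars t. card (U i))"
    by (rule card_UN_le[OF finite_vars])
  also have "\<dots> \<le> card (vars t) * 2"
    using sum_bounded_above[of "vars t" "\<lambda>i. card (U i)" 2] U by simp
  also have "\<dots> < card {..2 * k + 2}"
    using assms by simp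
  finally have "\<not> {..2 * k + 2} \<subseteq> (\<Union>i\<in>vars t. U i)"
    using card_mono[of "\<Union>i\<in>vars t. U i"] finite_vars U(1) by (meson finite_UN_I not_le)
  then obtain p where p: "p \<le> 2 * k + 2" "p \<notin> (\<Union>i\<in>vars t. U i)"
    by auto
  show ?thesis
  proof (rule that[OF p(1)])
    fix i X assume "i \<in> vars t" "\<rho> i = Vertices X" "finite X" "card X \<le> 2"
    then show "p \<notin> X" using p(2) by (auto simp: U_def)
  qed
qed

text \<open>
  Since \<open>t\<close> has the value \<open>Edge\<close>, each of its words is a variable with this value or a product of two
  sets that avoid \<open>p\<close>; thus the valuation in \<open>SR6\<close> obtained by marking any nonadjacent pair gives
  \<open>t\<close>, and hence \<open>s\<close>, the value \<open>3\<close>. Conversely, the words of \<open>s\<close> can have the value \<open>3\<close> for all these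
  markings only if they have the value \<open>Edge\<close>. A vertex uncovered by the variables of \<open>t\<close>
  suffices, because variables occurring only in \<open>s\<close> are sent to \<open>1\<close> if their sets contain \<open>p\<close>.
\<close>

lemma odd_cycle_semiring_eval_Edge:
  assumes id: "satisfies SR6 (t, s)" and card: "card (vars t) \<le> k"
    and \<rho>: "range \<rho> \<subseteq> carrier (odd_cycle_semiring k)"
    and t: "eval_term (odd_cycle_semiring k) \<rho> t = Edge"
  shows "eval_term (odd_cycle_semiring k) \<rho> s = Edge"
proof -
  define n where "n = 2 * k + 2"
  have G: "odd_cycle_semiring k = graph_semiring {..n} (cycle_edges n)"
    by (simp only: odd_cycle_semiring_def n_def)
  note \<rho>' = \<rho>[unfolded G]
  have ne: "X \<noteq> {}" if "\<rho> i = Vertices X" for i X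
  proof -
    have "\<rho> i \<in> carrier (graph_semiring {..n} (cycle_edges n))" using \<rho>' by blast
    then show ?thesis using that by auto
  qed
  obtain p where p: "p \<le> n" and
    avoid: "\<And>i X. i \<in> vars t \<Longrightarrow> \<rho> i = Vertices X \<Longrightarrow> finite X \<Longrightarrow> card X \<le> 2 \<Longrightarrow> p \<notin> X"
    using uncovered_vertex[OF card, of \<rho>] unfolding n_def by blast
  have tval: "word_value (graph_semiring {..n} (cycle_edges n)) \<rho> w = Edge" if "w \<in> words t" for w
    using t that eval_eq_Edge_iff[OF \<rho>'] by (simp add: G)
  define \<sigma> where "\<sigma> u v i = SR6_marking p u v (\<rho> i)" for u v i
  have \<sigma>: "range (\<sigma> u v) \<subseteq> carrier SR6" for u v
    using SR6_marking_carrier by (auto simp: \<sigma>_def)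
  have "word_value SR6 (\<sigma> u v) w = 3" if uv: "(u, v) \<notin> cycle_edges n" and w: "w \<in> words t" for u v w
    using w
  proof (cases rule: word_shape)
    case (one i)
    then show ?thesis using tval[OF w] by (simp add: \<sigma>_def)
  next
    case (two i j)
    then have "graph_mul (cycle_edges n) (\<rho> i) (\<rho> j) = Edge"
      using tval[OF w] by simp
    then obtain X Y where XY: "\<rho> i = Vertices X" "\<rho> j = Vertices Y" "X \<times> Y \<subseteq> cycle_edges n"
      by (cases "\<rho> i"; cases "\<rho> j") (auto split: if_splits)
    moreover have "i \<in> vars t" "j \<in> vars t"
      using w two by (force simp: vars_def)+
    moreover have "Y \<times> X \<subseteq> cycle_edges n"
      using XY cycle_edges_sym by blast
    ultimately have "p \<notin> X" "p \<notin> Y"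
      using avoid cycle_common_neighbours ne by metis+
    then show ?thesis
      using SR6_marking_mul[of X Y k u v p] XY uv p ne two
      by (simp add: \<sigma>_def n_def del: SR6_marking.simps)
  next
    case (long i j l x)
    then show ?thesis using tval[OF w] by (simp add: graph_long_word del: word_value.simps)
  qed
  then have "eval_term SR6 (\<sigma> u v) t = 3" if "(u, v) \<notin> cycle_edges n" for u v
    using SR6_eval_eq_3_iff[OF \<sigma>] that by blast
  then have "eval_term SR6 (\<sigma> u v) s = 3" if "(u, v) \<notin> cycle_edges n" for u v
    using id \<sigma> that by (simp add: satisfies_def)
  then have sval: "word_value SR6 (\<sigma> u v) w = 3" if "(u, v) \<notin> cycle_edges n" "w \<in> words s" for u v w
    using SR6_eval_eq_3_iff[OF \<sigma>] that by blast
  have pp: "(p, p) \<notin> cycle_edges n"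
    by (auto simp: cycle_edges_def n_def)
  have "word_value (graph_semiring {..n} (cycle_edges n)) \<rho> w = Edge" if w: "w \<in> words s" for w
    using w
  proof (cases rule: word_shape)
    case (one i)
    then show ?thesis
      using sval[OF pp w] by (cases "\<rho> i") (auto simp: \<sigma>_def split: if_splits)
  next
    case (two i j)
    then have "mul SR6 (SR6_marking p u v (\<rho> i)) (SR6_marking p u v (\<rho> j)) = 3"
      if "(u, v) \<notin> cycle_edges n" for u v
      using sval[OF that w] by (simp add: \<sigma>_def)
    then show ?thesis
      using SR6_marking_mul_converse[OF _ pp] two by simp
  next
    case (long i j l x)
    then show ?thesis using sval[OF pp w] by (simp add: SR6_long_word del: word_value.simps)
  qed
  then show ?thesis
    using eval_eq_Edge_iff[OF \<rho>'] by (simp add: G)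
qed

text \<open>
  With the variables of \<open>t\<close> mapped to \<open>3\<close> and all others to \<open>1\<close>, every other word has the value \<open>1\<close>.
\<close>

lemma SR6_linear_words_subset:
  assumes id: "satisfies SR6 (t, s)" and linear: "\<And>w. w \<in> words t \<Longrightarrow> \<exists>i. w = [i]"
  shows "words s \<subseteq> words t"
proof
  fix w assume w: "w \<in> words s"
  define \<sigma> :: "nat \<Rightarrow> nat" where "\<sigma> i = (if [i] \<in> words t then 3 else 1)" for i
  have \<sigma>: "range \<sigma> \<subseteq> carrier SR6"
    by (auto simp: \<sigma>_def SR6_def)
  have "word_value SR6 \<sigma> u = 3" if "u \<in> words t" for u
    using linear[OF that] that by (auto simp: \<sigma>_def)
  then have "eval_term SR6 \<sigma> s = 3"
    using id \<sigma> SR6_eval_eq_3_iff[OF \<sigma>, of t] by (simp add: satisfies_def)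
  then have val: "word_value SR6 \<sigma> w = 3"
    using w SR6_eval_eq_3_iff[OF \<sigma>] by blast
  show "w \<in> words t"
    using w
  proof (cases rule: word_shape)
    case (one i)
    then show ?thesis using val by (simp add: \<sigma>_def split: if_splits)
  next
    case (two i j)
    then show ?thesis using val
      by (auto simp: \<sigma>_def SR6_def doubleton_eq_iff split: if_splits)
  next
    case (long i j l x)
    then show ?thesis using val by (simp add: SR6_long_word del: word_value.simps)
  qed
qed

text \<open>
  If the value of \<open>t\<close> is a set of vertices, then no word of \<open>t\<close> is a proper product, and the
  identity forces all words of \<open>s\<close> to be among those of \<open>t\<close>.
\<close>

lemma odd_cycle_identity_below:
  assumes id: "satisfies SR6 (t, s)" and card: "card (vars t) \<le> k"
    and \<rho>: "range \<rho> \<subseteq> carrier (odd_cycle_semiring k)"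
  shows "below (odd_cycle_semiring k) (eval_term (odd_cycle_semiring k) \<rho> s)
    (eval_term (odd_cycle_semiring k) \<rho> t)"
proof (cases "eval_term (odd_cycle_semiring k) \<rho> t")
  case Top
  then show ?thesis by (simp add: odd_cycle_semiring_def below_Top)
next
  case Edge
  then show ?thesis
    using odd_cycle_semiring_eval_Edge[OF id card \<rho>] by (simp add: odd_cycle_semiring_def below_def)
next
  case (Vertices X)
  have linear: "\<exists>i. w = [i]" if w: "w \<in> words t" for w
  proof -
    have "below (odd_cycle_semiring k) (word_value (odd_cycle_semiring k) \<rho> w) (Vertices X)"
      using word_below_eval[OF ai_semiring_odd_cycle \<rho> w] Vertices by simp
    then have "word_value (odd_cycle_semiring k) \<rho> w \<notin> {Edge, Top}"
      by (auto simp: odd_cycle_semiring_def below_def)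
    with w show ?thesis
    proof (cases rule: word_shape)
      case (two i j)
      with \<open>word_value (odd_cycle_semiring k) \<rho> w \<notin> {Edge, Top}\<close> show ?thesis
        using graph_mul_cases[of _ "\<rho> i" "\<rho> j"] by (auto simp: odd_cycle_semiring_def)
    qed (auto simp: odd_cycle_semiring_def graph_long_word simp del: word_value.simps(3))
  qed
  show ?thesis
    by (rule eval_mono[OF ai_semiring_odd_cycle \<rho> SR6_linear_words_subset[OF id linear]])
qed

lemma odd_cycle_semiring_satisfies:
  assumes id: "satisfies SR6 e" and card: "card (vars (fst e)) \<le> k" "card (vars (snd e)) \<le> k"
  shows "satisfies (odd_cycle_semiring k) e"
  unfolding satisfies_def
proof (intro allI impI)
  obtain t s where e: "e = (t, s)" by fastforce
  fix \<rho> :: "nat \<Rightarrow> nat graph_elem" assume \<rho>: "range \<rho> \<subseteq> carrier (odd_cycle_semiring k)"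
  show "eval_term (odd_cycle_semiring k) \<rho> (fst e) = eval_term (odd_cycle_semiring k) \<rho> (snd e)"
  proof (rule below_antisym[OF ai_semiring_odd_cycle])
    show "below (odd_cycle_semiring k) (eval_term (odd_cycle_semiring k) \<rho> (fst e))
        (eval_term (odd_cycle_semiring k) \<rho> (snd e))"
      by (rule odd_cycle_identity_below) (use id card \<rho> satisfies_swap e in auto)
    show "below (odd_cycle_semiring k) (eval_term (odd_cycle_semiring k) \<rho> (snd e))
        (eval_term (odd_cycle_semiring k) \<rho> (fst e))"
      by (rule odd_cycle_identity_below) (use id card \<rho> e in auto)
  qed (simp_all add: eval_closed[OF ai_semiring_odd_cycle \<rho>])
qed

text \<open>
  A finite basis would have a bound \<open>k\<close> on the number of variables, so the odd cycle semiring for this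
  \<open>k\<close> would be a model of it outside the variety of \<open>SR6\<close>.
\<close>

lemma not_finitely_based_SR6: "\<not> finitely_based TYPE('u::infinite) SR6"
proof
  assume "finitely_based TYPE('u) SR6"
  then obtain \<Sigma> where fin: "finite \<Sigma>"
    and base: "(variety_gen SR6 :: 'u aisr set) = equational_class \<Sigma>"
    unfolding finitely_based_def by blast
  obtain f :: "nat \<Rightarrow> 'u" where f: "inj_on f (carrier SR6)"
    using finite_inj_to_infinite[OF finite_SR6] by blast
  have "copy f SR6 \<in> (variety_gen SR6 :: 'u aisr set)"
    using copy_in_equational_class_iff[OF ai_semiring_SR6 f] by (auto simp: variety_gen_def)
  then have SR6: "SR6 \<in> equational_class \<Sigma>"
    using base copy_in_equational_class_iff[OF ai_semiring_SR6 f] by auto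
  define k where "k = Max (insert 0 ((\<lambda>e. card (vars (fst e))) ` \<Sigma> \<union> (\<lambda>e. card (vars (snd e))) ` \<Sigma>))"
  have k: "card (vars (fst e)) \<le> k" "card (vars (snd e)) \<le> k" if "e \<in> \<Sigma>" for e
    using fin that by (auto simp: k_def intro!: Max_ge)
  let ?S = "odd_cycle_semiring k"
  note S = ai_semiring_odd_cycle[of k]
  have fin_S: "finite (carrier ?S)"
    by (simp add: odd_cycle_semiring_def finite_graph_semiring)
  obtain g :: "nat graph_elem \<Rightarrow> 'u" where g: "inj_on g (carrier ?S)"
    using finite_inj_to_infinite[OF fin_S] by blast
  have "?S \<in> equational_class \<Sigma>"
    using S SR6 odd_cycle_semiring_satisfies k by (simp add: equational_class_def)
  then have "copy g ?S \<in> variety_gen SR6"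
    using base copy_in_equational_class_iff[OF S g] by simp
  moreover have "SR6 \<in> equational_class {odd_cycle_identity k}"
    using SR6_odd_cycle_identity ai_semiring_SR6 by (simp add: equational_class_def)
  ultimately have "copy g ?S \<in> equational_class {odd_cycle_identity k}"
    unfolding variety_gen_def by blast
  then show False
    using copy_in_equational_class_iff[OF S g] odd_cycle_semiring_identity
    by (auto simp: equational_class_def)
qed

theorem theorem1p1:
  shows "\<not> finitely_based TYPE('u::infinite) SR6 \<and>
         \<not> strongly_nonfinitely_based TYPE('u) SR6"
  using not_finitely_based_SR6 not_strongly_nonfinitely_based_SR6 by blast

end
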